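(* Let $\{u_n\}_{n=1}^{\infty}$ be Sylvester's sequence, defined by $u_1=2$ and $u_{n+1}=u_n^2-u_n+1$ for $n\ge 1$. Let $N\ge 2$ be an integer, and let $\{a_n\}_{n=1}^{\infty}$ be a sequence of positive real numbers satisfying \[ a_{n+1}=a_n^2-a_n+1 \quad\text{for all } n\ge N, \] and also satisfying the two conditions \begin{itemize} \item[( * )] $\sum_{i=1}^{\infty}\frac{1}{a_i}=1$; \item[( ** )] $\sum_{i=1}^{N-1}\frac{1}{a_i}<\sum_{i=1}^{N-1}\frac{1}{u_i}$. \end{itemize} Then \[ \liminf_{n\to\infty} a_n^{\frac{1}{2^n}}=\lim_{n\to\infty} a_n^{\frac{1}{2^n}}<\lim_{n\to\infty} u_n^{\frac{1}{2^n}}. \]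
   Context: Sylvester's sequence is $2,3,7,43,1807,\dots$; it satisfies $\sum_{n=1}^\infty 1/u_n=1$. *)

theory Defs
  imports "HOL-Analysis.Analysis"
begin

end

theory Submission
  imports Defs
begin

text \<open>
  Under the recursion \<open>x \<mapsto> x\<^sup>2 - x + 1\<close> the reciprocals telescope:
  \<open>1 / x n = 1 / (x n - 1) - 1 / (x (n + 1) - 1)\<close>. Hence the sum of the reciprocals of \<open>a\<close> from
  index \<open>N\<close> on is \<open>1 / (a N - 1)\<close>, and likewise for \<open>u\<close>; since both total sums are 1, the
  assumption on the initial sums says \<open>a N < u N\<close>. From then on \<open>a n < u n\<close>, and as soon as
  \<open>(a n - 1) (u n - 1) \<ge> 1\<close> the quotient \<open>u n / a n > 1\<close> at least squares at each step, so that its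
  \<open>2 ^ n\<close>-th roots increase and separate the two limits.
\<close>

lemma power2_powr_inverse_power2:
  fixes x :: real
  assumes "x > 0"
  shows "(x\<^sup>2) powr (1 / 2 ^ Suc n) = x powr (1 / 2 ^ n)"
proof -
  have "(x\<^sup>2) powr (1 / 2 ^ Suc n) = (x powr 2) powr (1 / 2 ^ Suc n)"
    using assms by simp
  also have "\<dots> = x powr (1 / 2 ^ n)"
    by (simp add: powr_powr del: powr_numeral)
  finally show ?thesis .
qed

text \<open>Taking \<open>2 ^ Suc n\<close>-th roots in \<open>step\<close> shows that the roots
  increase with \<open>n\<close>. Applied to the quotients \<open>u n / a n\<close>, this gives a
  lower bound that does not depend on \<open>n\<close>.\<close>

lemma powr_inverse_power2_mono:
  fixes q :: "nat \<Rightarrow> real"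
  assumes pos: "\<And>n. n \<ge> M \<Longrightarrow> q n > 0"
    and step: "\<And>n. n \<ge> M \<Longrightarrow> (q n)\<^sup>2 \<le> q (Suc n)"
    and "n \<ge> M"
  shows "q M powr (1 / 2 ^ M) \<le> q n powr (1 / 2 ^ n)"
  using \<open>n \<ge> M\<close>
proof (induction n rule: dec_induct)
  case base
  show ?case by simp
next
  case (step n)
  have "q n powr (1 / 2 ^ n) = ((q n)\<^sup>2) powr (1 / 2 ^ Suc n)"
    using power2_powr_inverse_power2[OF pos] step.hyps by simp
  also have "\<dots> \<le> q (Suc n) powr (1 / 2 ^ Suc n)"
    using assms(2) step.hyps by (intro powr_mono2) auto
  finally show ?case using step.IH by simp
qed

context
  fixes x :: "nat \<Rightarrow> real" and M :: nat
  assumes rec: "\<And>n. n \<ge> M \<Longrightarrow> x (Suc n) = (x n)\<^sup>2 - x n + 1"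
begin

lemma sylvester_gt_1:
  assumes "x M > 1" "n \<ge> M"
  shows "x n > 1"
  using assms(2)
proof (induction n rule: dec_induct)
  case base
  show ?case using assms by simp
next
  case (step n)
  have "x n * (x n - 1) > 0"
    using step.IH by simp
  then show ?case
    using rec[of n] step.hyps by (simp add: power2_eq_square algebra_simps)
qed

text \<open>The interval from 0 (excluded) to 1 is invariant under the recursion. An orbit trapped
  there has reciprocals at least 1, so its reciprocal series diverges; this is how
  \<open>a N \<le> 1\<close> is ruled out.\<close>

lemma sylvester_le_1:
  assumes "0 < x M" "x M \<le> 1" "n \<ge> M"
  shows "0 < x n \<and> x n \<le> 1"
  using assms(3)
proof (induction n rule: dec_induct)
  case base
  show ?case using assms by simp
next
  case (step n)
  have "x (Suc n) = (x n)\<^sup>2 + (1 - x n)" "x (Suc n) = 1 - x n * (1 - x n)"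
    using rec[of n] step.hyps by (simp_all add: power2_eq_square algebra_simps)
  moreover have "(x n)\<^sup>2 > 0" "x n * (1 - x n) \<ge> 0"
    using step.IH by simp_all
  ultimately show ?case
    using step.IH by linarith
qed

text \<open>Partial fractions, from the factorisation
  \<open>x (Suc n) - 1 = x n * (x n - 1)\<close>.\<close>

lemma sum_inverse_sylvester:
  assumes "x M > 1" "n \<ge> M"
  shows "(\<Sum>i = M..<n. 1 / x i) = 1 / (x M - 1) - 1 / (x n - 1)"
  using assms(2)
proof (induction n rule: dec_induct)
  case base
  show ?case by simp
next
  case (step n)
  have gt: "x n > 1"
    using sylvester_gt_1 assms(1) step.hyps by simp
  have "x (Suc n) - 1 = x n * (x n - 1)"
    using rec[of n] step.hyps by (simp add: power2_eq_square algebra_simps)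
  then have "1 / (x (Suc n) - 1) = 1 / (x n - 1) - 1 / x n"
    using gt by (simp add: field_simps)
  then show ?case
    using step by simp
qed

text \<open>Above 1 the recursion gives \<open>x (Suc n) \<le> (x n)\<^sup>2\<close>, so the roots
  decrease from index \<open>M\<close> on, and they are bounded below by 0.\<close>

lemma convergent_sylvester_roots:
  assumes "x M > 1"
  shows "convergent (\<lambda>n. x n powr (1 / 2 ^ n))"
proof -
  have "x (Suc n) powr (1 / 2 ^ Suc n) \<le> x n powr (1 / 2 ^ n)" if "n \<ge> M" for n
  proof -
    have "x (Suc n) powr (1 / 2 ^ Suc n) \<le> ((x n)\<^sup>2) powr (1 / 2 ^ Suc n)"
      using sylvester_gt_1[OF assms, of n] sylvester_gt_1[OF assms, of "Suc n"] rec[of n] that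
      by (intro powr_mono2) auto
    then show ?thesis
      using power2_powr_inverse_power2[of "x n" n] sylvester_gt_1[OF assms that] by simp
  qed
  then have "decseq (\<lambda>n. x (n + M) powr (1 / 2 ^ (n + M)))"
    by (intro decseq_SucI) simp
  then obtain L where "(\<lambda>n. x (n + M) powr (1 / 2 ^ (n + M))) \<longlonglongrightarrow> L"
    by (rule decseq_convergent[of _ 0]) auto
  then have "(\<lambda>n. x n powr (1 / 2 ^ n)) \<longlonglongrightarrow> L"
    by (rule LIMSEQ_offset)
  then show ?thesis
    by (rule convergentI)
qed

end

theorem theorem1p5:
  fixes u a :: "nat \<Rightarrow> real" and N :: nat
  assumes u_1: "u 1 = 2"
    and u_rec: "\<And>n. n \<ge> 1 \<Longrightarrow> u (n + 1) = (u n)\<^sup>2 - u n + 1"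
    and N: "N \<ge> 2"
    and a_pos: "\<And>n. n \<ge> 1 \<Longrightarrow> a n > 0"
    and a_rec: "\<And>n. n \<ge> N \<Longrightarrow> a (n + 1) = (a n)\<^sup>2 - a n + 1"
    and a_sums: "(\<lambda>i. 1 / a (i + 1)) sums 1"
    and a_less: "(\<Sum>i = 1..N - 1. 1 / a i) < (\<Sum>i = 1..N - 1. 1 / u i)"
  shows "convergent (\<lambda>n. a n powr (1 / 2 ^ n))
    \<and> convergent (\<lambda>n. u n powr (1 / 2 ^ n))
    \<and> liminf (\<lambda>n. ereal (a n powr (1 / 2 ^ n))) = ereal (lim (\<lambda>n. a n powr (1 / 2 ^ n)))
    \<and> lim (\<lambda>n. a n powr (1 / 2 ^ n)) < lim (\<lambda>n. u n powr (1 / 2 ^ n))"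
proof -
  define A where "A n = a n powr (1 / 2 ^ n)" for n
  define U where "U n = u n powr (1 / 2 ^ n)" for n
  have u_rec': "u (Suc n) = (u n)\<^sup>2 - u n + 1" if "n \<ge> 1" for n
    using u_rec[OF that] by simp
  have a_rec': "a (Suc n) = (a n)\<^sup>2 - a n + 1" if "n \<ge> N" for n
    using a_rec[OF that] by simp
  have u_gt_1: "u n > 1" if "n \<ge> 1" for n
    using sylvester_gt_1[of 1 u n] u_rec' u_1 that by simp
  have lim_inv: "(\<lambda>n. 1 / a n) \<longlonglongrightarrow> 0"
    using sums_summable[OF a_sums, THEN summable_LIMSEQ_zero] LIMSEQ_imp_Suc[of "\<lambda>n. 1 / a n"]
    by simp
  have aN_gt_1: "a N > 1"
  proof (rule ccontr)
    assume "\<not> a N > 1"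
    then have "0 < a n \<and> a n \<le> 1" if "n \<ge> N" for n
      using sylvester_le_1[of N a n, OF a_rec' _ _ that] a_pos[of N] N by simp
    then have "1 / a n \<ge> 1" if "n \<ge> N" for n
      using that by (simp add: field_simps)
    then have "0 \<ge> (1::real)"
      using LIMSEQ_le_const[OF lim_inv] by blast
    then show False by simp
  qed
  have a_gt_1: "a n > 1" if "n \<ge> N" for n
    using sylvester_gt_1[of N a n, OF a_rec' aN_gt_1 that] .
  \<comment> \<open>No growth estimate is needed: the reciprocals are positive and tend to
    0.\<close>
  have a_top: "filterlim a at_top sequentially"
  proof -
    have "filterlim (\<lambda>n. inverse (1 / a n)) at_top sequentially"
      using lim_inv
    proof (rule filterlim_inverse_at_top)
      show "\<forall>\<^sub>F n in sequentially. 0 < 1 / a n"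
        using a_pos by (intro eventually_sequentiallyI[of 1]) simp
    qed
    then show ?thesis by simp
  qed
  have split: "{1..n} = {1..N - 1} \<union> {N..<Suc n}" if "n \<ge> N" for n
    using that N by auto
  \<comment> \<open>The partial sums have two limits to compare: 1 by \<open>a_sums\<close>, and the
    initial sum plus \<open>1 / (a N - 1)\<close> by telescoping the tail.\<close>
  have a_initial: "(\<Sum>i = 1..N - 1. 1 / a i) = 1 - 1 / (a N - 1)"
  proof -
    have "(\<Sum>i<n. 1 / a (i + 1)) = (\<Sum>i = 1..n. 1 / a i)" for n
      by (simp add: sum.atLeast1_atMost_eq)
    then have "(\<lambda>n. \<Sum>i = 1..n. 1 / a i) \<longlonglongrightarrow> 1"
      using a_sums by (simp add: sums_def)
    moreover have "\<forall>\<^sub>F n in sequentially. (\<Sum>i = 1..n. 1 / a i) =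
        (\<Sum>i = 1..N - 1. 1 / a i) + (1 / (a N - 1) - 1 / (a (Suc n) - 1))"
    proof (rule eventually_sequentiallyI[of N])
      fix n assume n: "n \<ge> N"
      have "(\<Sum>i = 1..n. 1 / a i) = (\<Sum>i = 1..N - 1. 1 / a i) + (\<Sum>i = N..<Suc n. 1 / a i)"
        unfolding split[OF n] by (rule sum.union_disjoint) auto
      then show "(\<Sum>i = 1..n. 1 / a i) =
          (\<Sum>i = 1..N - 1. 1 / a i) + (1 / (a N - 1) - 1 / (a (Suc n) - 1))"
        using sum_inverse_sylvester[of N a "Suc n", OF a_rec' aN_gt_1] n by simp
    qed
    ultimately have "(\<lambda>n. (\<Sum>i = 1..N - 1. 1 / a i) + (1 / (a N - 1) - 1 / (a (Suc n) - 1))) \<longlonglongrightarrow> 1"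
      by (rule Lim_transform_eventually)
    moreover have "(\<lambda>n. (\<Sum>i = 1..N - 1. 1 / a i) + (1 / (a N - 1) - 1 / (a (Suc n) - 1)))
        \<longlonglongrightarrow> (\<Sum>i = 1..N - 1. 1 / a i) + (1 / (a N - 1) - 0)"
    proof (intro tendsto_intros)
      have "filterlim (\<lambda>n. - 1 + a (Suc n)) at_top sequentially"
        using a_top by (intro filterlim_tendsto_add_at_top[OF tendsto_const])
          (simp add: filterlim_sequentially_Suc)
      then have "filterlim (\<lambda>n. - 1 + a (Suc n)) at_infinity sequentially"
        by (rule filterlim_at_top_imp_at_infinity)
      then have "(\<lambda>n. 1 / (- 1 + a (Suc n))) \<longlonglongrightarrow> 0"
        by (rule tendsto_divide_0[OF tendsto_const])
      then show "(\<lambda>n. 1 / (a (Suc n) - 1)) \<longlonglongrightarrow> 0"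
        by simp
    qed
    ultimately show ?thesis
      using LIMSEQ_unique by fastforce
  qed
  have "{1..N - 1} = {1..<N}"
    using N by auto
  \<comment> \<open>For \<open>u\<close> the finite telescoping from index 1 suffices, because
    \<open>u 1 - 1 = 1\<close>.\<close>
  then have u_initial: "(\<Sum>i = 1..N - 1. 1 / u i) = 1 - 1 / (u N - 1)"
    using sum_inverse_sylvester[of 1 u N] u_rec' u_1 N by simp
  have aN_less: "a N < u N"
  proof (rule ccontr)
    assume "\<not> a N < u N"
    then have "1 / (a N - 1) \<le> 1 / (u N - 1)"
      using u_gt_1[of N] N by (intro divide_left_mono) auto
    then show False
      using a_less a_initial u_initial by linarith
  qed
  have less: "a n < u n" if "n \<ge> N" for n
    using that
  proof (induction n rule: dec_induct)
    case base
    show ?case using aN_less .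
  next
    case (step n)
    \<comment> \<open>This product equals \<open>u (Suc n) - a (Suc n)\<close>.\<close>
    have "(u n - a n) * (u n + a n - 1) > 0"
      using step a_gt_1[of n] by simp
    then show ?case
      using a_rec'[of n] u_rec'[of n] step.hyps N by (simp add: power2_eq_square algebra_simps)
  qed
  \<comment> \<open>The threshold 2, together with \<open>a n < u n\<close>, makes both factors of
    \<open>(a n - 1) * (u n - 1)\<close> at least 1.\<close>
  obtain M where M: "M \<ge> N" "\<And>n. n \<ge> M \<Longrightarrow> a n \<ge> 2"
  proof -
    obtain M where "\<And>n. n \<ge> M \<Longrightarrow> a n \<ge> 2"
      using a_top unfolding filterlim_at_top eventually_sequentially by blast
    then show ?thesis
      using that[of "max M N"] by simp
  qed
  have ratio: "(u n / a n)\<^sup>2 \<le> u (Suc n) / a (Suc n)" if "n \<ge> M" for n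
  proof -
    have n_ge_1: "n \<ge> 1"
      using that M(1) N by simp
    have ge: "a n \<ge> 2" "u n > a n"
      using M that less by auto
    have "(a n - 1) * (u n - 1) \<ge> 1 * 1"
      using ge by (intro mult_mono) auto
    \<comment> \<open>Expanding \<open>(a n - 1) * (u n - 1) \<ge> 1\<close> shows that the second
      factor is nonnegative. The product is the difference of the two sides of the claim after
      clearing denominators.\<close>
    then have "(u n - a n) * (a n * u n - (a n + u n)) \<ge> 0"
      using ge by (intro mult_nonneg_nonneg) (auto simp: algebra_simps)
    moreover have "u (Suc n) * (a n)\<^sup>2 - (u n)\<^sup>2 * a (Suc n) =
        (u n - a n) * (a n * u n - (a n + u n))"
      unfolding a_rec'[OF order_trans[OF M(1) that]] u_rec'[OF n_ge_1]
      by (simp add: power2_eq_square algebra_simps)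
    ultimately have "(u n)\<^sup>2 * a (Suc n) \<le> u (Suc n) * (a n)\<^sup>2"
      by linarith
    moreover have "a n > 0" "a (Suc n) > 0"
      using a_pos n_ge_1 by simp_all
    ultimately show ?thesis
      by (simp add: power_divide divide_simps mult.commute)
  qed
  \<comment> \<open>The first of the increasing roots of \<open>u n / a n\<close>: a fixed factor
    above 1 between \<open>A n\<close> and \<open>U n\<close>, which survives passing to the
    limit.\<close>
  define c where "c = (u M / a M) powr (1 / 2 ^ M)"
  have "u M / a M > 1"
    using M(1) less[of M] a_gt_1[of M] by (simp add: less_divide_eq)
  then have c_gt_1: "c > 1"
    unfolding c_def by (intro gr_one_powr) auto
  have U_ge: "c * A n \<le> U n" if "n \<ge> M" for n
  proof -
    have "c \<le> (u n / a n) powr (1 / 2 ^ n)"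
      unfolding c_def
    proof (rule powr_inverse_power2_mono)
      show "u k / a k > 0" if "k \<ge> M" for k
        using a_gt_1[of k] less[of k] M(1) that by simp
    qed (use ratio that in auto)
    also have "\<dots> = U n / A n"
      using a_gt_1[of n] less[of n] M(1) that by (simp add: U_def A_def powr_divide)
    finally show ?thesis
      using a_gt_1[of n] M(1) that by (simp add: A_def pos_le_divide_eq)
  qed
  have A_conv: "convergent A"
    using convergent_sylvester_roots[of N a, OF a_rec' aN_gt_1] unfolding A_def .
  have U_conv: "convergent U"
    using convergent_sylvester_roots[of 1 u] u_rec' u_1 unfolding U_def by simp
  have A_lim: "A \<longlonglongrightarrow> lim A" and U_lim: "U \<longlonglongrightarrow> lim U"
    using A_conv U_conv by (simp_all add: convergent_LIMSEQ_iff)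
  \<comment> \<open>Positivity of \<open>lim A\<close> is what makes
    \<open>lim A < c * lim A\<close> strict.\<close>
  have "A n \<ge> 1" if "n \<ge> M" for n
    using M(2)[OF that] by (simp add: A_def ge_one_powr_ge_zero)
  then have "lim A \<ge> 1"
    using LIMSEQ_le_const[OF A_lim] by blast
  then have "lim A < c * lim A"
    using c_gt_1 by simp
  also have "\<dots> \<le> lim U"
    using LIMSEQ_le[OF tendsto_mult_left[OF A_lim] U_lim] U_ge by blast
  finally have "lim A < lim U" .
  moreover have "liminf (\<lambda>n. ereal (A n)) = ereal (lim A)"
    using A_lim by (intro lim_imp_Liminf) auto
  ultimately show ?thesis
    using A_conv U_conv unfolding A_def U_def by simp
qed

end
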